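(* Let $p$ be the probability function defined by a Bayesian network over a finite set $V$ of discrete variables, and let $\mathcal{T}$ be a junction tree for the network. Let $a$ be a value of a variable $A\in V$, let $e$ be the available evidence, and let $x=p(b_i\mid\pi)$ be a parameter of the network, where $b_i$ is a value of a variable $B\in V$ with domain $\{b_1,\dots,b_m\}$ and $\pi$ is a combination of values of the parents $\Pi=\mathrm{pa}(B)$; assume that the initially specified value satisfies $0<p(b_i\mid\pi)<1$. Suppose that, in $\mathcal{T}$, an inward propagation (with evidence $e$) has been performed towards a clique containing $A$ and that subsequently an outward propagation from this clique has been performed with the value $a$ for $A$. Let $K$ be a clique of $\mathcal{T}$ with $\{B\}\cup\Pi\subseteq K$, and let $\phi_K=p(K,a,e)$ be the potential of $K$ after these propagations. Then, as a function of $x\in[0,1]$, $$p(a,e)(x)=\alpha x+\beta,$$ with $$\alpha=\frac{\sum_{K:b_i,\pi}\phi_K}{p(b_i\mid\pi)}-\sum_{j\neq i}\frac{\sum_{K:b_j,\pi}\phi_K}{1-p(b_i\mid\pi)},\qquad \beta=\sum_{j\neq i}\frac{\sum_{K:b_j,\pi}\phi_K}{1-p(b_i\mid\pi)}+\sum_{K:\Pi\neq\pi}\phi_K .$$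
   Context: A Bayesian network over a finite set $V$ of variables with finite domains consists of a directed acyclic graph on $V$ and, for each $X\in V$ and each combination of values of its parents $\mathrm{pa}(X)$, a conditional probability distribution on $\mathrm{dom}(X)$ whose entries are the parameters of the network. It defines the joint probability function $p(V)=\prod_{X\in V}p(X\mid \mathrm{pa}(X))$. Evidence $e$ is an assignment of values to some subset of the variables. Co-variation convention: the parameter $p(b_i\mid\pi)$ is varied to an arbitrary value $x\in[0,1]$, and the other parameters of the same conditional distribution are scaled proportionally: $$p(b_j\mid\pi)(x)=\begin{cases}x & j=i,\\ p(b_j\mid\pi)\,\dfrac{1-x}{1-p(b_i\mid\pi)} & j\ne i,\end{cases}$$ where $p(b_i\mid\pi)<1$. All other parameters stay fixed. Symbols $p(\cdot\mid\cdot)$ without an argument $x$ denote the initially specified values. For an event $E$, $p(E)(x)$ denotes the probability of $E$ under the network with the varied parameters; e.g. $p(a,e)(x)$ is the resulting probability that $A=a$ and $e$ holds. Potentials: after the described propagations in the junction tree (performed with the initial parameter values), the potential of a clique $K\subseteq V$ is the table $\phi_K=p(K,a,e)$ that assigns to each configuration $k$ of the variables in $K$ the initial probability of the joint event "$K=k$, $A=a$, and $e$" (zero if inconsistent). Summation notation: $\sum_{K:b_j,\pi}\phi_K$ is the sum of $\phi_K$ over all configurations of $K$ with $B=b_j$ and $\Pi=\pi$; $\sum_{K:\Pi\ne\pi}\phi_K$ is the sum over all configurations of $K$ with $\Pi\neq\pi$. *)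

theory Defs
  imports Complex_Main "HOL-Library.FuncSet"
begin

text \<open>
  The values of all variables live in one type \<^typ>\<open>'d\<close>; \<open>vals N X\<close> is the domain of \<open>X\<close>.
  A configuration of a set \<open>S\<close> of variables is a function that is \<^const>\<open>undefined\<close> outside \<open>S\<close>.
  The parameter p(b | \<open>\<rho>\<close>) of variable \<open>X\<close> is \<open>cpt N X b \<rho>\<close>, with \<open>\<rho>\<close> a configuration of the
  parents of \<open>X\<close>.
\<close>

record ('v, 'd) bayes_net =
  vars :: "'v set"
  vals :: "'v \<Rightarrow> 'd set"
  pars :: "'v \<Rightarrow> 'v set"
  cpt :: "'v \<Rightarrow> 'd \<Rightarrow> ('v \<Rightarrow> 'd) \<Rightarrow> real"

definition configs :: "('v, 'd) bayes_net \<Rightarrow> 'v set \<Rightarrow> ('v \<Rightarrow> 'd) set" where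
  "configs N S = (\<Pi>\<^sub>E X\<in>S. vals N X)"

definition bayesian_network :: "('v, 'd) bayes_net \<Rightarrow> bool" where
  "bayesian_network N \<longleftrightarrow>
     finite (vars N) \<and>
     (\<forall>X\<in>vars N. finite (vals N X) \<and> vals N X \<noteq> {}) \<and>
     (\<forall>X\<in>vars N. pars N X \<subseteq> vars N) \<and>
     acyclic {(Y, X). X \<in> vars N \<and> Y \<in> pars N X} \<and>
     (\<forall>X\<in>vars N. \<forall>\<rho>\<in>configs N (pars N X).
        (\<forall>b\<in>vals N X. 0 \<le> cpt N X b \<rho>) \<and> (\<Sum>b\<in>vals N X. cpt N X b \<rho>) = 1)"

definition joint :: "('v, 'd) bayes_net \<Rightarrow> ('v \<Rightarrow> 'd) \<Rightarrow> real" where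
  "joint N v = (\<Prod>X\<in>vars N. cpt N X (v X) (restrict v (pars N X)))"

definition event_prob :: "('v, 'd) bayes_net \<Rightarrow> (('v \<Rightarrow> 'd) \<Rightarrow> bool) \<Rightarrow> real" where
  "event_prob N E = (\<Sum>v\<in>{v\<in>configs N (vars N). E v}. joint N v)"

definition evidence :: "('v, 'd) bayes_net \<Rightarrow> ('v \<rightharpoonup> 'd) \<Rightarrow> bool" where
  "evidence N e \<longleftrightarrow> dom e \<subseteq> vars N \<and> (\<forall>X y. e X = Some y \<longrightarrow> y \<in> vals N X)"

definition agrees :: "('v \<rightharpoonup> 'd) \<Rightarrow> 'v set \<Rightarrow> ('v \<Rightarrow> 'd) \<Rightarrow> bool" where
  "agrees e S v \<longleftrightarrow> (\<forall>X\<in>dom e \<inter> S. e X = Some (v X))"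

definition covary ::
  "('v, 'd) bayes_net \<Rightarrow> 'v \<Rightarrow> 'd \<Rightarrow> ('v \<Rightarrow> 'd) \<Rightarrow> real \<Rightarrow> ('v, 'd) bayes_net" where
  "covary N B bi \<pi> x = N\<lparr>cpt := \<lambda>X b \<rho>.
     if X = B \<and> \<rho> = \<pi>
     then (if b = bi then x else cpt N B b \<pi> * ((1 - x) / (1 - cpt N B bi \<pi>)))
     else cpt N X b \<rho>\<rparr>"

text \<open>
  A junction tree is an undirected tree whose nodes are sets of variables; edges are two-element
  sets of nodes. Its defining properties are that the intersection of two nodes lies in every node
  on the path between them, and that each variable occurs together with its parents in some node.
  The nodes are not required to be maximal cliques of a triangulated moral graph.
\<close>

record 'v jtree =
  cliques :: "'v set set"
  links :: "'v set set set"

definition tree_path :: "'v jtree \<Rightarrow> 'v set \<Rightarrow> 'v set list \<Rightarrow> 'v set \<Rightarrow> bool" where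
  "tree_path T C ps D \<longleftrightarrow>
     ps \<noteq> [] \<and> hd ps = C \<and> last ps = D \<and> distinct ps \<and> set ps \<subseteq> cliques T \<and>
     successively (\<lambda>C' D'. {C', D'} \<in> links T) ps"

definition is_tree :: "'v jtree \<Rightarrow> bool" where
  "is_tree T \<longleftrightarrow>
     finite (cliques T) \<and> cliques T \<noteq> {} \<and>
     links T \<subseteq> {{C, D} | C D. C \<in> cliques T \<and> D \<in> cliques T \<and> C \<noteq> D} \<and>
     (\<forall>C\<in>cliques T. \<forall>D\<in>cliques T. \<exists>!ps. tree_path T C ps D)"

definition junction_tree :: "('v, 'd) bayes_net \<Rightarrow> 'v jtree \<Rightarrow> bool" where
  "junction_tree N T \<longleftrightarrow>
     is_tree T \<and>
     (\<forall>C\<in>cliques T. C \<subseteq> vars N) \<and>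
     (\<forall>X\<in>vars N. \<exists>C\<in>cliques T. insert X (pars N X) \<subseteq> C) \<and>
     (\<forall>C D ps. tree_path T C ps D \<longrightarrow> (\<forall>W\<in>set ps. C \<inter> D \<subseteq> W))"

text \<open>
  Propagation is done in the style of Jensen, Lauritzen and Olesen: cliques and separators carry
  potentials, and a message from \<open>C\<close> to \<open>D\<close> replaces the separator potential by the marginal of
  the potential of \<open>C\<close> and multiplies the potential of \<open>D\<close> by the quotient of the new and the old
  separator potential. The convention 0 / 0 = 0 of that scheme is the one of real division here.
\<close>

type_synonym ('v, 'd) potential = "('v \<Rightarrow> 'd) \<Rightarrow> real"

record ('v, 'd) jt_state =
  clique_pot :: "'v set \<Rightarrow> ('v, 'd) potential"
  sep_pot :: "'v set set \<Rightarrow> ('v, 'd) potential"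

definition marginal ::
  "('v, 'd) bayes_net \<Rightarrow> 'v set \<Rightarrow> 'v set \<Rightarrow> ('v, 'd) potential \<Rightarrow> ('v, 'd) potential" where
  "marginal N C S \<phi> s = (\<Sum>c\<in>{c\<in>configs N C. restrict c S = s}. \<phi> c)"

definition pass_message ::
  "('v, 'd) bayes_net \<Rightarrow> 'v set \<times> 'v set \<Rightarrow> ('v, 'd) jt_state \<Rightarrow> ('v, 'd) jt_state" where
  "pass_message N = (\<lambda>(C, D) st.
     let S = C \<inter> D; old = sep_pot st {C, D}; new = marginal N C S (clique_pot st C)
     in \<lparr>clique_pot = (clique_pot st)(D := \<lambda>d.
           clique_pot st D d * (new (restrict d S) / old (restrict d S))),
         sep_pot = (sep_pot st)({C, D} := new)\<rparr>)"

definition family_assignment :: "('v, 'd) bayes_net \<Rightarrow> 'v jtree \<Rightarrow> ('v \<Rightarrow> 'v set) \<Rightarrow> bool" where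
  "family_assignment N T home \<longleftrightarrow>
     (\<forall>X\<in>vars N. home X \<in> cliques T \<and> insert X (pars N X) \<subseteq> home X)"

definition initial_state :: 
  "('v, 'd) bayes_net \<Rightarrow> ('v \<Rightarrow> 'v set) \<Rightarrow> ('v \<rightharpoonup> 'd) \<Rightarrow> ('v, 'd) jt_state" where
  "initial_state N home e =
     \<lparr>clique_pot = \<lambda>C c.
        (\<Prod>X\<in>{X\<in>vars N. home X = C}. cpt N X (c X) (restrict c (pars N X))) *
        (if agrees e C c then 1 else 0),
      sep_pot = \<lambda>_ _. 1\<rparr>"

definition enter_finding ::
  "'v set \<Rightarrow> 'v \<Rightarrow> 'd \<Rightarrow> ('v, 'd) jt_state \<Rightarrow> ('v, 'd) jt_state" where
  "enter_finding C A a st =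
     st\<lparr>clique_pot := (clique_pot st)(C := \<lambda>c. if c A = a then clique_pot st C c else 0)\<rparr>"

text \<open>
  A schedule lists messages as pairs (sender, receiver). Inwards, every clique other than the root
  \<open>R\<close> sends exactly one message, to a neighbour which is \<open>R\<close> or sends its own message later;
  outwards, every clique other than \<open>R\<close> receives exactly one message, from a neighbour which is
  \<open>R\<close> or has received its own message before.
\<close>

definition inward_schedule :: "'v jtree \<Rightarrow> 'v set \<Rightarrow> ('v set \<times> 'v set) list \<Rightarrow> bool" where
  "inward_schedule T R ms \<longleftrightarrow>
     distinct (map fst ms @ [R]) \<and> set (map fst ms @ [R]) = cliques T \<and>
     (\<forall>i<length ms. {fst (ms ! i), snd (ms ! i)} \<in> links T \<and>
        snd (ms ! i) \<in> set (map fst (drop (Suc i) ms) @ [R]))"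

definition outward_schedule :: "'v jtree \<Rightarrow> 'v set \<Rightarrow> ('v set \<times> 'v set) list \<Rightarrow> bool" where
  "outward_schedule T R ms \<longleftrightarrow>
     distinct (R # map snd ms) \<and> set (R # map snd ms) = cliques T \<and>
     (\<forall>i<length ms. {fst (ms ! i), snd (ms ! i)} \<in> links T \<and>
        fst (ms ! i) \<in> set (R # map snd (take i ms)))"

definition propagated_state ::
  "('v, 'd) bayes_net \<Rightarrow> ('v \<Rightarrow> 'v set) \<Rightarrow> ('v \<rightharpoonup> 'd) \<Rightarrow> 'v set \<Rightarrow> 'v \<Rightarrow> 'd \<Rightarrow>
   ('v set \<times> 'v set) list \<Rightarrow> ('v set \<times> 'v set) list \<Rightarrow> ('v, 'd) jt_state" where
  "propagated_state N home e R A a ins outs =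
     fold (pass_message N) outs
       (enter_finding R A a (fold (pass_message N) ins (initial_state N home e)))"

text \<open>The sum of \<open>\<phi>\<close> over the configurations of \<open>K\<close> with \<open>B = b\<close> and parents of \<open>B\<close> in state \<open>\<pi>\<close>.\<close>

definition family_sum ::
  "('v, 'd) bayes_net \<Rightarrow> 'v set \<Rightarrow> ('v, 'd) potential \<Rightarrow> 'v \<Rightarrow> 'd \<Rightarrow> ('v \<Rightarrow> 'd) \<Rightarrow> real" where
  "family_sum N K \<phi> B b \<pi> =
     (\<Sum>k\<in>{k\<in>configs N K. k B = b \<and> restrict k (pars N B) = \<pi>}. \<phi> k)"

definition other_parents_sum ::
  "('v, 'd) bayes_net \<Rightarrow> 'v set \<Rightarrow> ('v, 'd) potential \<Rightarrow> 'v \<Rightarrow> ('v \<Rightarrow> 'd) \<Rightarrow> real" where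
  "other_parents_sum N K \<phi> B \<pi> =
     (\<Sum>k\<in>{k\<in>configs N K. restrict k (pars N B) \<noteq> \<pi>}. \<phi> k)"

end

theory Submission
  imports Defs
begin

text \<open>
  The inward schedule eliminates the leaves of the junction tree one after the other: the first
  sender \<open>C\<close> meets the union \<open>U\<close> of the remaining cliques exactly in its separator \<open>S\<close>, so the
  product of all potentials splits as \<open>g(C) r(U)\<close>, and summing out \<open>C - S\<close> multiplies \<open>r\<close> by the
  marginal of \<open>g\<close> on \<open>S\<close>, which is the message. In the opposite direction, the marginal of the
  product on \<open>C\<close> is \<open>g\<close> times the marginal of \<open>r\<close> on \<open>S\<close>, and the latter is the quotient of the
  new and the old separator potential. Hence every final clique potential is the marginal
  \<open>p(K, a, e)\<close>. Co-variation multiplies \<open>joint N v\<close> by a factor, affine in \<open>x\<close>, that depends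
  only on the values of \<open>B\<close> and its parents, so it can be pulled out of the sum over each
  configuration of \<open>K\<close>.
\<close>

section \<open>Configurations and marginals of potentials\<close>

lemma finite_configs:
  assumes "bayesian_network N" "S \<subseteq> vars N"
  shows "finite (configs N S)"
  unfolding configs_def
proof (rule finite_PiE)
  show "finite S" using assms by (auto simp: bayesian_network_def elim: finite_subset)
  show "finite (vals N X)" if "X \<in> S" for X
    using assms that by (auto simp: bayesian_network_def)
qed

lemma restrict_in_configs:
  assumes "v \<in> configs N U" "S \<subseteq> U"
  shows "restrict v S \<in> configs N S"
  using assms by (auto simp: configs_def PiE_iff)

lemma restrict_configs_id:
  "v \<in> configs N U \<Longrightarrow> restrict v U = v"
  by (auto simp: configs_def PiE_iff)

lemma marginal_cong:
  assumes "\<And>c. c \<in> configs N U \<Longrightarrow> restrict c S = s \<Longrightarrow> f c = g c"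
  shows "marginal N U S f s = marginal N U S g s"
  unfolding marginal_def using assms by (intro sum.cong) auto

lemma marginal_self:
  assumes "s \<in> configs N U"
  shows "marginal N U U f s = f s"
proof -
  have "{c \<in> configs N U. restrict c U = s} = {s}"
    using assms by (auto simp: restrict_configs_id)
  then show ?thesis by (simp add: marginal_def)
qed

lemma marginal_mult_right:
  "marginal N U S (\<lambda>c. f c * k) s = marginal N U S f s * k"
  by (simp add: marginal_def sum_distrib_right)

lemma marginal_nonneg:
  assumes "\<And>c. c \<in> configs N U \<Longrightarrow> 0 \<le> f c"
  shows "0 \<le> marginal N U S f s"
  unfolding marginal_def using assms by (intro sum_nonneg) auto

text \<open>Tower property: a configuration of \<open>U\<close> restricts to \<open>S'\<close>
  through \<open>S\<close>, so the fibre over \<open>t\<close> is partitioned by the values on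
  \<open>S\<close>.\<close>

lemma marginal_marginal:
  assumes fin: "finite (configs N U)" "finite (configs N S)" and "S' \<subseteq> S" "S \<subseteq> U"
  shows "marginal N S S' (marginal N U S f) t = marginal N U S' f t"
proof -
  let ?V = "{v \<in> configs N U. restrict v S' = t}"
  let ?W = "{c \<in> configs N S. restrict c S' = t}"
  have "marginal N S S' (marginal N U S f) t = (\<Sum>c\<in>?W. \<Sum>v\<in>{v \<in> ?V. restrict v S = c}. f v)"
    unfolding marginal_def using assms(3)
    by (intro sum.cong refl) (auto simp: Int_absorb1)
  also have "\<dots> = (\<Sum>v\<in>?V. f v)"
    using fin assms(3,4)
    by (intro sum.group) (auto simp: restrict_in_configs Int_absorb1)
  finally show ?thesis by (simp add: marginal_def)
qed

text \<open>With the part on \<open>C\<close> fixed to \<open>c\<close>, extending it to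
  \<open>C \<union> U\<close> amounts to choosing a configuration of \<open>U\<close> that agrees
  with \<open>c\<close> on the overlap. The factor \<open>g\<close> is then constant, and only
  \<open>r\<close> is summed.\<close>

lemma marginal_glue:
  assumes c: "c \<in> configs N C"
  shows "marginal N (C \<union> U) C (\<lambda>v. g (restrict v C) * r (restrict v U)) c
    = g c * marginal N U (C \<inter> U) r (restrict c (C \<inter> U))"
proof -
  let ?V = "{v \<in> configs N (C \<union> U). restrict v C = c}"
  let ?W = "{u \<in> configs N U. restrict u (C \<inter> U) = restrict c (C \<inter> U)}"
  let ?glue = "\<lambda>u X. if X \<in> C then c X else u X"
  have "(\<Sum>v\<in>?V. g (restrict v C) * r (restrict v U)) = (\<Sum>u\<in>?W. g c * r u)"
  proof (rule sum.reindex_bij_witness[where i = ?glue and j = "\<lambda>v. restrict v U"])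
    fix v assume v: "v \<in> ?V"
    then have vc: "v X = c X" if "X \<in> C" for X using that by auto
    show "?glue (restrict v U) = v"
      using v vc by (auto simp: configs_def PiE_iff extensional_def fun_eq_iff)
    show "restrict v U \<in> ?W"
      using v vc by (auto simp: restrict_in_configs fun_eq_iff)
    show "g c * r (restrict v U) = g (restrict v C) * r (restrict v U)"
      using v by auto
  next
    fix u assume u: "u \<in> ?W"
    then have uc: "u X = c X" if "X \<in> C" "X \<in> U" for X
      using that by (auto dest: fun_cong[of _ _ X])
    show "restrict (?glue u) U = u"
      using u uc by (auto simp: configs_def PiE_iff extensional_def fun_eq_iff)
    show "?glue u \<in> ?V"
      using u c by (auto simp: configs_def PiE_iff extensional_def fun_eq_iff)
  qed
  then show ?thesis by (simp add: marginal_def sum_distrib_left)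
qed

lemma marginal_glue_right:
  assumes u: "u \<in> configs N U"
  shows "marginal N (C \<union> U) U (\<lambda>v. g (restrict v C) * r (restrict v U)) u
    = r u * marginal N C (C \<inter> U) g (restrict u (C \<inter> U))"
  using marginal_glue[OF u, where U = C and g = r and r = g] by (simp add: Un_commute Int_commute mult.commute)

section \<open>The effect of messages on potentials\<close>

lemma pass_message_simps:
  "clique_pot (pass_message N (C, D) st) E =
     (if E = D then \<lambda>d. clique_pot st D d *
        (marginal N C (C \<inter> D) (clique_pot st C) (restrict d (C \<inter> D)) / sep_pot st {C, D} (restrict d (C \<inter> D)))
      else clique_pot st E)"
  "sep_pot (pass_message N (C, D) st) L =
     (if L = {C, D} then marginal N C (C \<inter> D) (clique_pot st C) else sep_pot st L)"
  by (auto simp: pass_message_def Let_def)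

lemma clique_pot_fold_unchanged:
  "C \<notin> snd ` set ms \<Longrightarrow> clique_pot (fold (pass_message N) ms st) C = clique_pot st C"
  by (induction ms arbitrary: st) (auto simp: pass_message_simps)

lemma sep_pot_fold_unchanged:
  "(\<And>C D. (C, D) \<in> set ms \<Longrightarrow> L \<noteq> {C, D}) \<Longrightarrow>
   sep_pot (fold (pass_message N) ms st) L = sep_pot st L"
proof (induction ms arbitrary: st)
  case (Cons m ms)
  then show ?case by (cases m) (auto simp: pass_message_simps)
qed simp

section \<open>Correctness of the two passes along an elimination order\<close>

text \<open>The running intersection property for the elimination order given by a list of (clique, parent) pairs.\<close>

fun rip_order :: "'v set \<Rightarrow> ('v set \<times> 'v set) list \<Rightarrow> bool" where
  "rip_order R [] \<longleftrightarrow> True"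
| "rip_order R ((C, D) # ms) \<longleftrightarrow>
     C \<notin> insert R (fst ` set ms) \<and> D \<in> insert R (fst ` set ms) \<and>
     (\<forall>E\<in>insert R (fst ` set ms). C \<inter> E \<subseteq> D) \<and> rip_order R ms"

lemma rip_order_receivers:
  "rip_order R ms \<Longrightarrow> snd ` set ms \<subseteq> insert R (fst ` set ms)"
  by (induction R ms rule: rip_order.induct) auto

text \<open>
  The family \<open>\<chi>\<close> of final potentials is characterised by its recursion along the tree, since the
  order of the outward messages need not be the reverse of the inward one; \<open>h\<close> is the finding
  entered at the root between the two passes.
\<close>

lemma two_pass_marginals:
  assumes "rip_order R ms"
    and "\<And>S. S \<subseteq> \<Union>(insert R (fst ` set ms)) \<Longrightarrow> finite (configs N S)"
    and "\<And>C c. C \<in> insert R (fst ` set ms) \<Longrightarrow> c \<in> configs N C \<Longrightarrow> 0 \<le> clique_pot st C c"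
    and "\<And>C D. (C, D) \<in> set ms \<Longrightarrow> sep_pot st {C, D} = (\<lambda>_. 1)"
    and "st' = fold (pass_message N) ms st"
    and "\<And>c. c \<in> configs N R \<Longrightarrow> \<chi> R c = h c * clique_pot st' R c"
    and "\<And>C D c. (C, D) \<in> set ms \<Longrightarrow> c \<in> configs N C \<Longrightarrow>
      \<chi> C c = clique_pot st' C c *
        (marginal N D (C \<inter> D) (\<chi> D) (restrict c (C \<inter> D)) / sep_pot st' {C, D} (restrict c (C \<inter> D)))"
    and "E \<in> insert R (fst ` set ms)" and "s \<in> configs N E"
  shows "\<chi> E s = marginal N (\<Union>(insert R (fst ` set ms))) E
    (\<lambda>v. h (restrict v R) * (\<Prod>C\<in>insert R (fst ` set ms). clique_pot st C (restrict v C))) s"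
  using assms
proof (induction ms arbitrary: st E s)
  case Nil
  then show ?case by (simp add: marginal_self restrict_configs_id del: restrict_apply)
next
  case (Cons m ms)
  obtain C D where m: "m = (C, D)" by force
  define X where "X = insert R (fst ` set ms)"
  define U where "U = \<Union>X"
  define S where "S = C \<inter> D"
  define st1 where "st1 = pass_message N (C, D) st"
  define new where "new = marginal N C S (clique_pot st C)"
  define r where "r = (\<lambda>u. h (restrict u R) * (\<Prod>E\<in>X. clique_pot st E (restrict u E)))"
  define F' where "F' = (\<lambda>u. h (restrict u R) * (\<Prod>E\<in>X. clique_pot st1 E (restrict u E)))"
  have XX: "insert R (fst ` set (m # ms)) = insert C X" by (auto simp: m X_def)
  have C: "C \<notin> X" and D: "D \<in> X" and rip: "\<And>E. E \<in> X \<Longrightarrow> C \<inter> E \<subseteq> D"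
    and ord: "rip_order R ms"
    using Cons.prems(1) by (auto simp: m X_def)
  have RX: "R \<in> X" and finX: "finite X" by (auto simp: X_def)
  \<comment> \<open>Running intersection: whatever \<open>C\<close> shares with any remaining clique
    already lies in \<open>D\<close>, so the separator is the whole interface between
    \<open>C\<close> and \<open>U\<close>.\<close>
  have SU: "C \<inter> U = S" using D rip by (auto simp: U_def S_def)
  have subU: "E \<subseteq> U" if "E \<in> X" for E using that by (auto simp: U_def)
  have recv: "snd ` set ms \<subseteq> X" using rip_order_receivers[OF ord] by (simp add: X_def)
  have send: "fst ` set ms \<subseteq> X" by (auto simp: X_def)
  have untouched: "E \<noteq> C" "E' \<noteq> C" if "(E, E') \<in> set ms" for E E'
    using that recv send C by force+
  have sep1: "sep_pot st {C, D} = (\<lambda>_. 1)" using Cons.prems(4) by (simp add: m)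
  have CD: "C \<noteq> D" using C D by auto
  have fin: "finite (configs N W)" if "W \<subseteq> C \<union> U" for W
    using that Cons.prems(2) unfolding XX by (simp add: U_def)
  have nn: "\<And>E c. E \<in> insert C X \<Longrightarrow> c \<in> configs N E \<Longrightarrow> 0 \<le> clique_pot st E c"
    using Cons.prems(3) unfolding XX by blast
  have new0: "0 \<le> new s" for s
    unfolding new_def by (rule marginal_nonneg) (use nn in auto)
  have pot1: "clique_pot st1 E = (if E = D then \<lambda>d. clique_pot st D d * new (restrict d S)
      else clique_pot st E)" for E
    by (simp add: st1_def pass_message_simps sep1 new_def S_def)
  \<comment> \<open>On the remaining cliques, the first message only multiplies the factor of
    \<open>D\<close> by \<open>new\<close>; the old separator potential is 1, so no quotient is
    left.\<close>
  have F': "F' u = r u * new (restrict u S)" for u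
  proof -
    have "(\<Prod>E\<in>X. clique_pot st1 E (restrict u E))
        = clique_pot st1 D (restrict u D) * (\<Prod>E\<in>X - {D}. clique_pot st1 E (restrict u E))"
      using finX D by (rule prod.remove)
    also have "(\<Prod>E\<in>X - {D}. clique_pot st1 E (restrict u E)) = (\<Prod>E\<in>X - {D}. clique_pot st E (restrict u E))"
      by (intro prod.cong) (auto simp: pot1)
    also have "clique_pot st1 D (restrict u D) = clique_pot st D (restrict u D) * new (restrict u S)"
      by (simp add: pot1 S_def Int_absorb1)
    finally show ?thesis
      using prod.remove[OF finX D, of "\<lambda>E. clique_pot st E (restrict u E)"]
      by (simp del: restrict_apply add: F'_def r_def mult_ac)
  qed
  \<comment> \<open>The conditions on \<open>\<chi>\<close> refer only to the end state
    \<open>st'\<close>, which is also the end state of the shorter schedule started in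
    \<open>st1\<close>. Nonnegativity survives because \<open>new\<close> is nonnegative, and the
    separators of later messages do not involve \<open>C\<close>.\<close>
  have IH: "\<chi> E s = marginal N U E F' s" if E: "E \<in> X" and s: "s \<in> configs N E" for E s
    unfolding U_def F'_def X_def
  proof (rule Cons.IH[OF ord])
    show "finite (configs N W)" if "W \<subseteq> \<Union>(insert R (fst ` set ms))" for W
      using that by (intro fin) (auto simp: U_def X_def)
    show "0 \<le> clique_pot st1 E c" if "E \<in> insert R (fst ` set ms)" "c \<in> configs N E" for E c
      using that nn[of E c] new0 by (auto simp: pot1 X_def)
    show "sep_pot st1 {E, E'} = (\<lambda>_. 1)" if "(E, E') \<in> set ms" for E E'
      using that untouched[OF that] Cons.prems(4)
      by (auto simp: st1_def pass_message_simps doubleton_eq_iff)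
    show "st' = fold (pass_message N) ms st1"
      using Cons.prems(5) by (simp add: m st1_def)
    show "\<chi> R c = h c * clique_pot st' R c" if "c \<in> configs N R" for c
      using that by (rule Cons.prems(6))
    show "E \<in> insert R (fst ` set ms)" "s \<in> configs N E" using E s by (auto simp: X_def)
  qed (rule Cons.prems(7), auto)
  \<comment> \<open>After the first message, both ends of every message lie in \<open>X\<close>. So
    \<open>C\<close> keeps its initial potential, and the separator of \<open>C\<close> and
    \<open>D\<close> keeps the value \<open>new\<close>.\<close>
  have potC: "clique_pot st' C = clique_pot st C"
  proof -
    have "C \<notin> snd ` set ms" using C recv by blast
    then show ?thesis
      using CD by (simp add: Cons.prems(5) m clique_pot_fold_unchanged pass_message_simps)
  qed
  have sepC: "sep_pot st' {C, D} = new"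
    using untouched unfolding Cons.prems(5)
    by (simp add: m, subst sep_pot_fold_unchanged)
      (auto simp: pass_message_simps new_def S_def doubleton_eq_iff)
  have split: "h (restrict v R) * (\<Prod>E\<in>insert C X. clique_pot st E (restrict v E))
      = clique_pot st C (restrict v C) * r (restrict v U)" for v
    using C finX subU RX by (simp add: r_def Int_absorb1 cong: prod.cong)
  show ?case
    unfolding XX split
  proof (cases "E = C")
    case False
    then have E: "E \<in> X" using Cons.prems(8) unfolding XX by auto
    have "\<chi> E s = marginal N U E F' s" using IH E Cons.prems(9) by blast
    \<comment> \<open>For a remaining clique, \<open>F'\<close> is the full product with the
      variables of \<open>C\<close> outside \<open>S\<close> summed out: \<open>r\<close> is
      constant in them, and \<open>g\<close> leaves its marginal \<open>new\<close>.\<close>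
    also have "\<dots> = marginal N U E (marginal N (C \<union> U) U
        (\<lambda>v. clique_pot st C (restrict v C) * r (restrict v U))) s"
      by (intro marginal_cong) (simp add: marginal_glue_right SU F' new_def)
    also have "\<dots> = marginal N (C \<union> U) E (\<lambda>v. clique_pot st C (restrict v C) * r (restrict v U)) s"
      using subU[OF E] by (intro marginal_marginal fin) auto
    finally show "\<chi> E s = marginal N (\<Union>(insert C X)) E (\<lambda>v. clique_pot st C (restrict v C) * r (restrict v U)) s"
      by (simp add: U_def)
  next
    case True
    then have s: "s \<in> configs N C" using Cons.prems(9) by simp
    let ?t = "restrict s S"
    \<comment> \<open>The final potential of \<open>D\<close> still contains the inward message as
      the factor \<open>new\<close>. Dividing by the stored separator potential removes it, so that
      \<open>C\<close> does not count its own contribution twice.\<close>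
    have "marginal N D S (\<chi> D) ?t = marginal N D S (marginal N U D F') ?t"
      by (intro marginal_cong IH D)
    also have "\<dots> = marginal N U S F' ?t"
      using subU[OF D] by (intro marginal_marginal fin) (auto simp: S_def)
    also have "\<dots> = marginal N U S (\<lambda>u. r u * new ?t) ?t"
      by (intro marginal_cong) (simp add: F')
    finally have D_marg: "marginal N D S (\<chi> D) ?t = marginal N U S r ?t * new ?t"
      by (simp add: marginal_mult_right)
    \<comment> \<open>This makes the convention 0 / 0 = 0 of the message quotient harmless.\<close>
    have "clique_pot st C s = 0" if "new ?t = 0"
    proof -
      have "\<forall>c\<in>{c \<in> configs N C. restrict c S = ?t}. clique_pot st C c = 0"
        using that nn fin[of C] unfolding new_def marginal_def
        by (subst (asm) sum_nonneg_eq_0_iff) auto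
      then show ?thesis using s by auto
    qed
    moreover have "\<chi> C s = clique_pot st C s * (marginal N D S (\<chi> D) ?t / new ?t)"
      using Cons.prems(7)[of C D s] s by (simp add: m potC sepC S_def del: restrict_apply)
    ultimately have "\<chi> C s = clique_pot st C s * marginal N U S r ?t"
      by (auto simp: D_marg)
    then show "\<chi> E s = marginal N (\<Union>(insert C X)) E (\<lambda>v. clique_pot st C (restrict v C) * r (restrict v U)) s"
      using marginal_glue[OF s, of U "clique_pot st C" r] by (simp add: True SU flip: U_def)
  qed
qed

section \<open>The outward pass\<close>

text \<open>\<open>Z\<close> collects the root and the cliques that have already received a message.
  Requiring \<open>C \<notin> Z\<close> says that a clique in \<open>Z\<close> has its final
  potential.\<close>

fun outward_order :: "'v set set \<Rightarrow> ('v set \<times> 'v set) list \<Rightarrow> bool" where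
  "outward_order Z [] \<longleftrightarrow> True"
| "outward_order Z ((P, C) # ms) \<longleftrightarrow> P \<in> Z \<and> C \<notin> Z \<and> outward_order (insert C Z) ms"

lemma outward_order_receivers:
  "outward_order Z ms \<Longrightarrow> Z \<inter> snd ` set ms = {}"
  by (induction Z ms rule: outward_order.induct) auto

text \<open>A sender lies in \<open>Z\<close> and receives nothing afterwards, so the potential it
  sends from is already its final one. Before its single message, the receiver \<open>C\<close>
  takes part in no message, so its potential and the separator are still those of \<open>st\<close>.
  This gives a recursion with the end state \<open>st'\<close> at the sender and the start state
  \<open>st\<close> elsewhere.\<close>

lemma fold_outward:
  assumes "outward_order Z ms" "(P, C) \<in> set ms"
    and "st' = fold (pass_message N) ms st"
  shows "clique_pot st' C c = clique_pot st C c *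
    (marginal N P (P \<inter> C) (clique_pot st' P) (restrict c (P \<inter> C)) / sep_pot st {P, C} (restrict c (P \<inter> C)))"
  using assms
proof (induction Z ms arbitrary: st rule: outward_order.induct)
  case (2 Z P' C' ms)
  have ord: "outward_order (insert C' Z) ms" and P': "P' \<in> Z" and C': "C' \<notin> Z" using "2.prems" by auto
  have recv: "insert C' Z \<inter> snd ` set ms = {}"
    using outward_order_receivers[OF ord] .
  have P'C': "P' \<noteq> C'" using P' C' by auto
  show ?case
  proof (cases "(P, C) \<in> set ms")
    case True
    then have C: "C \<in> snd ` set ms" by force
    then have "C \<noteq> C'" "C \<noteq> P'" using recv P' by auto
    then show ?thesis
      using "2.IH"[OF ord True] "2.prems"(3) by (simp add: pass_message_simps doubleton_eq_iff del: restrict_apply)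
  next
    case False
    then have "P = P'" "C = C'" using "2.prems" by auto
    moreover have "clique_pot st' P' = clique_pot st P'"
      "clique_pot st' C' = clique_pot (pass_message N (P', C') st) C'"
      using "2.prems"(3) recv P' P'C'
      by (auto simp: clique_pot_fold_unchanged pass_message_simps disjoint_iff)
    ultimately show ?thesis by (simp add: pass_message_simps del: restrict_apply)
  qed
qed simp

section \<open>Schedules and paths in the tree\<close>

lemma tree_path_Cons:
  assumes "tree_path T D ps E" "C \<in> cliques T" "{C, D} \<in> links T" "C \<notin> set ps"
  shows "tree_path T C (C # ps) E"
  using assms by (auto simp: tree_path_def successively_Cons)

lemma tree_path_rev:
  assumes "tree_path T D ps E"
  shows "tree_path T E (rev ps) D"
  using assms by (auto simp: tree_path_def hd_rev last_rev successively_rev insert_commute)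

text \<open>Paths must stay inside \<open>X\<close>: a path between members of \<open>X\<close> then
  avoids any clique outside \<open>X\<close> and remains a path when such a neighbour is put in
  front of it.\<close>

definition linked :: "'v jtree \<Rightarrow> 'v set set \<Rightarrow> bool" where
  "linked T X \<longleftrightarrow> (\<forall>D\<in>X. \<forall>E\<in>X. \<exists>ps. tree_path T D ps E \<and> set ps \<subseteq> X)"

lemma linked_singleton: "C \<in> cliques T \<Longrightarrow> linked T {C}"
  by (auto simp: linked_def tree_path_def intro!: exI[of _ "[C]"])

lemma linked_insert:
  assumes X: "linked T X" and D: "D \<in> X" and C: "C \<in> cliques T" "C \<notin> X" and l: "{C, D} \<in> links T"
  shows "linked T (insert C X)"
proof -
  have ex: "\<exists>ps. tree_path T C ps E \<and> set ps \<subseteq> insert C X" if E: "E \<in> X" for E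
  proof -
    obtain ps where ps: "tree_path T D ps E" "set ps \<subseteq> X" using X D E unfolding linked_def by blast
    then have "tree_path T C (C # ps) E" using C l by (intro tree_path_Cons) auto
    then show ?thesis using ps by (intro exI[of _ "C # ps"]) auto
  qed
  have ex': "\<exists>ps. tree_path T E ps C \<and> set ps \<subseteq> insert C X" if E: "E \<in> X" for E
    using ex[OF E] tree_path_rev by (metis set_rev)
  have self: "\<exists>ps. tree_path T C ps C \<and> set ps \<subseteq> insert C X"
    using C by (intro exI[of _ "[C]"]) (auto simp: tree_path_def)
  show ?thesis
    unfolding linked_def
  proof (intro ballI)
    fix D' E assume "D' \<in> insert C X" "E \<in> insert C X"
    then consider "D' = C" "E = C" | "D' = C" "E \<in> X" | "D' \<in> X" "E = C" | "D' \<in> X" "E \<in> X" by blast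
    then show "\<exists>ps. tree_path T D' ps E \<and> set ps \<subseteq> insert C X"
    proof cases
      case 4
      then have "\<exists>ps. tree_path T D' ps E \<and> set ps \<subseteq> X" using X by (simp add: linked_def)
      then show ?thesis by (blast intro: subset_insertI2)
    qed (simp_all add: self ex ex')
  qed
qed

lemma inward_schedule_Cons:
  assumes "distinct (map fst ((C, D) # ms) @ [R])"
    and "\<forall>i<length ((C, D) # ms).
        {fst (((C, D) # ms) ! i), snd (((C, D) # ms) ! i)} \<in> links T \<and>
        snd (((C, D) # ms) ! i) \<in> set (map fst (drop (Suc i) ((C, D) # ms)) @ [R])"
  shows "{C, D} \<in> links T" "D \<in> insert R (fst ` set ms)" "C \<notin> insert R (fst ` set ms)"
    "\<forall>i<length ms. {fst (ms ! i), snd (ms ! i)} \<in> links T \<and>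
        snd (ms ! i) \<in> set (map fst (drop (Suc i) ms) @ [R])"
proof -
  show "{C, D} \<in> links T" "D \<in> insert R (fst ` set ms)"
    using assms(2)[rule_format, of 0] by auto
  show "C \<notin> insert R (fst ` set ms)" using assms(1) by auto
  show "\<forall>i<length ms. {fst (ms ! i), snd (ms ! i)} \<in> links T \<and>
        snd (ms ! i) \<in> set (map fst (drop (Suc i) ms) @ [R])"
  proof (intro allI impI)
    fix i assume "i < length ms"
    then show "{fst (ms ! i), snd (ms ! i)} \<in> links T \<and>
        snd (ms ! i) \<in> set (map fst (drop (Suc i) ms) @ [R])"
      using assms(2)[rule_format, of "Suc i"] by simp
  qed
qed

text \<open>Read backwards, the schedule grows a subtree from \<open>R\<close>, attaching each
  sender \<open>C\<close> to its receiver \<open>D\<close>. Every path from \<open>C\<close> to an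
  older clique can thus be taken through \<open>D\<close>, and the junction property on that path
  gives the running intersection. The last conjunct records that \<open>D\<close> is the next clique
  after \<open>C\<close> on the way to \<open>R\<close>, which ties the inward messages to the
  outward ones.\<close>

lemma inward_rip_order:
  assumes rip: "\<forall>C D ps. tree_path T C ps D \<longrightarrow> (\<forall>W\<in>set ps. C \<inter> D \<subseteq> W)"
    and "distinct (map fst ms @ [R])" "set (map fst ms @ [R]) \<subseteq> cliques T"
    and "\<forall>i<length ms. {fst (ms ! i), snd (ms ! i)} \<in> links T \<and>
        snd (ms ! i) \<in> set (map fst (drop (Suc i) ms) @ [R])"
  shows "rip_order R ms \<and> linked T (insert R (fst ` set ms)) \<and>
    (\<forall>(C, D)\<in>set ms. \<exists>ps. tree_path T D ps R \<and> tree_path T C (C # ps) R)"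
  using assms(2-)
proof (induction ms)
  case Nil
  then show ?case by (simp add: linked_singleton)
next
  case (Cons m ms)
  obtain C D where m: "m = (C, D)" by force
  define X where "X = insert R (fst ` set ms)"
  note step = inward_schedule_Cons[OF Cons.prems(1,3)[unfolded m], folded X_def]
  have IH: "rip_order R ms" "linked T X"
    "\<forall>(C, D)\<in>set ms. \<exists>ps. tree_path T D ps R \<and> tree_path T C (C # ps) R"
    using Cons.IH[OF _ _ step(4)] Cons.prems by (auto simp: m X_def)
  have C: "C \<in> cliques T" using Cons.prems by (auto simp: m)
  have path: "\<exists>ps. tree_path T D ps E \<and> tree_path T C (C # ps) E" if E: "E \<in> X" for E
  proof -
    obtain ps where "tree_path T D ps E" "set ps \<subseteq> X"
      using IH(2) step(2) E unfolding linked_def by blast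
    then show ?thesis using C step(1,3) by (blast intro: tree_path_Cons)
  qed
  have "C \<inter> E \<subseteq> D" if "E \<in> X" for E
  proof -
    obtain ps where "tree_path T D ps E" "tree_path T C (C # ps) E" using path \<open>E \<in> X\<close> by blast
    \<comment> \<open>\<open>D\<close> is the head of \<open>ps\<close>, hence a node on the path
      from \<open>C\<close> to \<open>E\<close>.\<close>
    then show ?thesis using rip[rule_format, of C "C # ps" E D] by (auto simp: tree_path_def)
  qed
  then have "rip_order R (m # ms)" using step IH(1) by (auto simp: m X_def)
  moreover have "linked T (insert R (fst ` set (m # ms)))"
    using linked_insert[OF IH(2) step(2) C step(3,1)] by (simp add: m X_def insert_commute)
  moreover have "R \<in> X" by (simp add: X_def)
  ultimately show ?case using IH(3) path by (auto simp: m)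
qed

lemma outward_orderI:
  assumes "distinct (map snd ms)" "Z \<inter> snd ` set ms = {}"
    and "\<forall>i<length ms. fst (ms ! i) \<in> Z \<union> snd ` set (take i ms)"
  shows "outward_order Z ms"
  using assms
proof (induction ms arbitrary: Z)
  case (Cons m ms)
  obtain P C where m: "m = (P, C)" by force
  have "P \<in> Z" using Cons.prems(3)[rule_format, of 0] by (simp add: m)
  moreover have "outward_order (insert C Z) ms"
  proof (rule Cons.IH)
    show "\<forall>i<length ms. fst (ms ! i) \<in> insert C Z \<union> snd ` set (take i ms)"
    proof (intro allI impI)
      fix i assume "i < length ms"
      then show "fst (ms ! i) \<in> insert C Z \<union> snd ` set (take i ms)"
        using Cons.prems(3)[rule_format, of "Suc i"] by (simp add: m)
    qed
  qed (use Cons.prems in \<open>auto simp: m\<close>)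
  ultimately show ?case using Cons.prems(2) by (simp add: m)
qed simp

lemma outward_schedule_order:
  "outward_schedule T R ms \<Longrightarrow> outward_order {R} ms"
  unfolding outward_schedule_def by (rule outward_orderI) auto

text \<open>The reached set \<open>Z\<close> stays connected as it grows. When \<open>C\<close> is
  reached from \<open>P\<close>, a path from \<open>P\<close> to \<open>R\<close> inside
  \<open>Z\<close> avoids \<open>C\<close>, so \<open>C\<close> can be put in front.\<close>

lemma outward_paths:
  assumes "outward_order Z ms" "linked T Z" "R \<in> Z" "snd ` set ms \<subseteq> cliques T"
    and "\<forall>(P, C)\<in>set ms. {P, C} \<in> links T" and "(P, C) \<in> set ms"
  shows "\<exists>ps. tree_path T P ps R \<and> tree_path T C (C # ps) R"
  using assms
proof (induction Z ms rule: outward_order.induct)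
  case (2 Z P' C' ms)
  have PC': "P' \<in> Z" "C' \<in> cliques T" "C' \<notin> Z" "{C', P'} \<in> links T"
    using "2.prems" by (auto simp: insert_commute)
  show ?case
  proof (cases "(P, C) = (P', C')")
    case True
    obtain ps where "tree_path T P' ps R" "set ps \<subseteq> Z"
      using "2.prems"(2,3) PC' unfolding linked_def by blast
    then show ?thesis using True PC' by (blast intro: tree_path_Cons)
  next
    case False
    then show ?thesis
      using "2.IH" "2.prems" linked_insert[OF "2.prems"(2) PC'] by auto
  qed
qed simp

text \<open>The outward schedule gives \<open>C\<close> some sender \<open>P\<close>, which is the
  second node on a path from \<open>C\<close> to \<open>R\<close>. Such a path is unique in a tree,
  so \<open>P\<close> is the clique \<open>D\<close> on the given path.\<close>

lemma inward_outward_same_edges: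
  assumes tree: "is_tree T" and out: "outward_schedule T R outs" and R: "R \<in> cliques T"
    and C: "C \<in> cliques T" "C \<noteq> R"
    and path: "tree_path T D ps R" "tree_path T C (C # ps) R"
  shows "(D, C) \<in> set outs"
proof -
  have "C \<in> snd ` set outs" using out C by (auto simp: outward_schedule_def)
  then obtain P where P: "(P, C) \<in> set outs" by force
  have links: "\<forall>(P, C)\<in>set outs. {P, C} \<in> links T"
    using out by (fastforce simp: outward_schedule_def in_set_conv_nth)
  have "snd ` set outs \<subseteq> cliques T" using out by (auto simp: outward_schedule_def)
  then obtain qs where qs: "tree_path T P qs R" "tree_path T C (C # qs) R"
    using outward_paths[OF outward_schedule_order[OF out] linked_singleton[OF R] _ _ links P] by auto
  have "C # ps = C # qs" using tree C R path(2) qs(2) unfolding is_tree_def by blast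
  then have "P = D" using path(1) qs(1) by (auto simp: tree_path_def)
  then show ?thesis using P by simp
qed

section \<open>From initial potentials to final clique probabilities\<close>

lemma Union_cliques:
  assumes "junction_tree N T"
  shows "\<Union>(cliques T) = vars N"
proof -
  have "\<forall>C\<in>cliques T. C \<subseteq> vars N" "\<forall>X\<in>vars N. \<exists>C\<in>cliques T. insert X (pars N X) \<subseteq> C"
    using assms by (simp_all add: junction_tree_def)
  then show ?thesis by blast
qed

text \<open>Each conditional distribution sits in exactly one clique, its home, so regrouping by
  \<open>home\<close> recovers the joint probability. The evidence indicator is entered in every
  clique; the repetition is harmless because its values are 0 and 1.\<close>

lemma prod_initial_state:
  assumes bn: "bayesian_network N" and jt: "junction_tree N T"
    and home: "family_assignment N T home"
  shows "(\<Prod>C\<in>cliques T. clique_pot (initial_state N home e) C (restrict v C))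
    = joint N v * (if agrees e (vars N) v then 1 else 0)"
proof -
  have fin: "finite (vars N)" "finite (cliques T)"
    using bn jt by (auto simp: bayesian_network_def junction_tree_def is_tree_def)
  \<comment> \<open>The cliques cover all variables, so global agreement with the evidence is
    agreement on each clique.\<close>
  have cov: "agrees e (vars N) v \<longleftrightarrow> (\<forall>C\<in>cliques T. agrees e C (restrict v C))"
    unfolding agrees_def Union_cliques[OF jt, symmetric] by auto
  have "(\<Prod>C\<in>cliques T. if agrees e C (restrict v C) then 1 else (0::real))
      = (if agrees e (vars N) v then 1 else 0)"
    unfolding cov using fin by (auto intro!: prod_zero)
  moreover have "(\<Prod>C\<in>cliques T. \<Prod>X\<in>{X\<in>vars N. home X = C}.
      cpt N X (restrict v C X) (restrict (restrict v C) (pars N X))) = joint N v"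
  proof -
    have "(\<Prod>C\<in>cliques T. \<Prod>X\<in>{X\<in>vars N. home X = C}.
        cpt N X (restrict v C X) (restrict (restrict v C) (pars N X)))
      = (\<Prod>C\<in>cliques T. \<Prod>X\<in>{X\<in>vars N. home X = C}. cpt N X (v X) (restrict v (pars N X)))"
      using home by (intro prod.cong refl) (auto simp: family_assignment_def Int_absorb1)
    also have "\<dots> = joint N v"
      unfolding joint_def using fin home by (intro prod.group) (auto simp: family_assignment_def)
    finally show ?thesis .
  qed
  ultimately show ?thesis by (simp add: initial_state_def prod.distrib)
qed

lemma initial_state_nonneg:
  assumes bn: "bayesian_network N" and home: "family_assignment N T home" and c: "c \<in> configs N C"
  shows "0 \<le> clique_pot (initial_state N home e) C c"
proof -
  have "0 \<le> cpt N X (c X) (restrict c (pars N X))" if "X \<in> vars N" "home X = C" for X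
  proof -
    have "insert X (pars N X) \<subseteq> C" using that home by (auto simp: family_assignment_def)
    then have "c X \<in> vals N X" "restrict c (pars N X) \<in> configs N (pars N X)"
      using c by (auto simp: configs_def PiE_iff)
    then show ?thesis using bn that by (auto simp: bayesian_network_def)
  qed
  then show ?thesis by (auto simp: initial_state_def intro!: mult_nonneg_nonneg prod_nonneg)
qed

text \<open>An instance of \<open>two_pass_marginals\<close> with the final clique potentials as
  \<open>\<chi>\<close> and the indicator of the value \<open>a\<close> as \<open>h\<close>. The
  recursion required of \<open>\<chi>\<close> is supplied by the outward pass, which uses each
  inward edge in the opposite direction.\<close>

lemma propagated_clique_pot:
  assumes bn: "bayesian_network N" and jt: "junction_tree N T"
    and home: "family_assignment N T home"
    and R: "R \<in> cliques T" "A \<in> R"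
    and ins: "inward_schedule T R ins" and outs: "outward_schedule T R outs"
    and K: "K \<in> cliques T" and k: "k \<in> configs N K"
  shows "clique_pot (propagated_state N home e R A a ins outs) K k
    = event_prob N (\<lambda>v. restrict v K = k \<and> v A = a \<and> agrees e (vars N) v)"
proof -
  have tree: "is_tree T"
    and rip: "\<forall>C D ps. tree_path T C ps D \<longrightarrow> (\<forall>W\<in>set ps. C \<inter> D \<subseteq> W)"
    using jt by (simp_all add: junction_tree_def)
  have cl: "insert R (fst ` set ins) = cliques T" using ins by (auto simp: inward_schedule_def)
  have Un: "\<Union>(cliques T) = vars N"
    using jt by (rule Union_cliques)
  have fin: "finite (configs N S)" if "S \<subseteq> vars N" for S
    using bn that by (rule finite_configs)
  define st where "st = initial_state N home e"
  define st' where "st' = fold (pass_message N) ins st"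
  define sta where "sta = enter_finding R A a st'"
  define fin_st where "fin_st = propagated_state N home e R A a ins outs"
  have fin_st: "fin_st = fold (pass_message N) outs sta"
    by (simp add: fin_st_def propagated_state_def sta_def st'_def st_def)
  define h where "h = (\<lambda>c. if c A = a then 1 else (0::real))"
  have sched: "distinct (map fst ins @ [R])" "set (map fst ins @ [R]) \<subseteq> cliques T"
    and neighbours: "\<forall>i<length ins. {fst (ins ! i), snd (ins ! i)} \<in> links T \<and>
       snd (ins ! i) \<in> set (map fst (drop (Suc i) ins) @ [R])"
    using ins unfolding inward_schedule_def by simp_all
  note rip_ins = inward_rip_order[OF rip sched neighbours]
  have in_ord: "rip_order R ins" using rip_ins by blast
  have paths: "\<exists>ps. tree_path T D ps R \<and> tree_path T C (C # ps) R" if "(C, D) \<in> set ins" for C D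
    using rip_ins that by blast
  have out_ord: "outward_order {R} outs" using outs by (rule outward_schedule_order)
  have "clique_pot fin_st K k = marginal N (\<Union>(cliques T)) K
    (\<lambda>v. h (restrict v R) * (\<Prod>C\<in>cliques T. clique_pot st C (restrict v C))) k"
    unfolding cl[symmetric]
  proof (rule two_pass_marginals[OF in_ord _ _ _ st'_def])
    show "finite (configs N S)" if "S \<subseteq> \<Union>(insert R (fst ` set ins))" for S
      using that unfolding cl Un by (rule fin)
    show "0 \<le> clique_pot st C c" if "c \<in> configs N C" for C c
      using bn home that unfolding st_def by (rule initial_state_nonneg)
    show "sep_pot st {C, D} = (\<lambda>_. 1)" for C D
      by (simp add: st_def initial_state_def)
    \<comment> \<open>The root receives no outward message, so only the finding separates its final
      potential from the one after the inward pass.\<close>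
    show "clique_pot fin_st R c = h c * clique_pot st' R c" for c
      using outward_order_receivers[OF out_ord]
      by (simp add: fin_st clique_pot_fold_unchanged sta_def enter_finding_def h_def)
    show "clique_pot fin_st C c = clique_pot st' C c *
        (marginal N D (C \<inter> D) (clique_pot fin_st D) (restrict c (C \<inter> D)) / sep_pot st' {C, D} (restrict c (C \<inter> D)))"
      if CD: "(C, D) \<in> set ins" for C D c
    proof -
      have C: "C \<in> cliques T" "C \<noteq> R"
        using image_eqI[OF _ CD, of C fst] sched(1,2) by auto
      have "(D, C) \<in> set outs"
        using paths[OF CD] inward_outward_same_edges[OF tree outs R(1) C] by blast
      \<comment> \<open>The finding changes the potential of \<open>R\<close> only. Since
        \<open>C\<close> is not \<open>R\<close>, the outward pass starts at \<open>C\<close> and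
        its separator from the values left by the inward pass.\<close>
      from fold_outward[OF out_ord this fin_st] C(2) show ?thesis
        by (simp add: sta_def enter_finding_def Int_commute insert_commute)
    qed
    show "K \<in> insert R (fst ` set ins)" using K unfolding cl .
  qed (rule k)
  \<comment> \<open>As \<open>A\<close> belongs to \<open>R\<close>, the finding entered at the root
    can be read off \<open>v\<close> itself.\<close>
  also have "\<dots> = marginal N (vars N) K (\<lambda>v. if v A = a \<and> agrees e (vars N) v then joint N v else 0) k"
    unfolding Un st_def prod_initial_state[OF bn jt home]
    using R by (intro marginal_cong) (auto simp: h_def)
  also have "\<dots> = event_prob N (\<lambda>v. restrict v K = k \<and> v A = a \<and> agrees e (vars N) v)"
    unfolding marginal_def event_prob_def
    by (rule sum.mono_neutral_cong_right) (auto simp: fin)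
  finally show ?thesis by (simp add: fin_st_def)
qed

section \<open>Co-variation and the affine form\<close>

text \<open>Only the factor of \<open>B\<close> changes. For \<open>bi\<close> the ratio of new to
  old value exists because the old one is positive; the other entries are scaled by definition, so
  zeros among them cause no division by zero.\<close>

lemma joint_covary:
  assumes bn: "bayesian_network N" and B: "B \<in> vars N" and p: "0 < cpt N B bi \<pi>" "cpt N B bi \<pi> < 1"
  shows "joint (covary N B bi \<pi> x) v =
    (if restrict v (pars N B) \<noteq> \<pi> then 1
     else if v B = bi then x / cpt N B bi \<pi> else (1 - x) / (1 - cpt N B bi \<pi>)) * joint N v"
proof -
  have fin: "finite (vars N)" using bn by (simp add: bayesian_network_def)
  have rest: "(\<Prod>X\<in>vars N - {B}. cpt (covary N B bi \<pi> x) X (v X) (restrict v (pars N X)))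
      = (\<Prod>X\<in>vars N - {B}. cpt N X (v X) (restrict v (pars N X)))"
    by (intro prod.cong) (auto simp: covary_def)
  have same: "vars (covary N B bi \<pi> x) = vars N" "pars (covary N B bi \<pi> x) = pars N"
    by (simp_all add: covary_def)
  show ?thesis
    unfolding joint_def same prod.remove[OF fin B] rest
    using p by (auto simp: covary_def)
qed

lemma sum_configs_by_family:
  fixes f :: "('v \<Rightarrow> 'd) \<Rightarrow> real"
  assumes fin: "finite (configs N K)" "finite (vals N B)" and B: "B \<in> K"
  shows "(\<Sum>k\<in>configs N K. f k) = (\<Sum>b\<in>vals N B. family_sum N K f B b \<pi>) + other_parents_sum N K f B \<pi>"
proof -
  let ?P = "{k \<in> configs N K. restrict k (pars N B) = \<pi>}"
  have "(\<Sum>b\<in>vals N B. family_sum N K f B b \<pi>) = (\<Sum>b\<in>vals N B. \<Sum>k\<in>{k \<in> ?P. k B = b}. f k)"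
    unfolding family_sum_def by (intro sum.cong refl) auto
  also have "\<dots> = (\<Sum>k\<in>?P. f k)"
    using fin B by (intro sum.group) (auto simp: configs_def)
  finally have "(\<Sum>b\<in>vals N B. family_sum N K f B b \<pi>) = (\<Sum>k\<in>?P. f k)" .
  moreover have "configs N K - ?P = {k \<in> configs N K. restrict k (pars N B) \<noteq> \<pi>}" by auto
  ultimately show ?thesis
    using sum.subset_diff[of ?P "configs N K" f] fin by (simp add: other_parents_sum_def)
qed

lemma event_prob_covary:
  fixes N :: "('v, 'd) bayes_net"
  assumes bn: "bayesian_network N" and B: "B \<in> vars N" "bi \<in> vals N B"
    and p: "0 < cpt N B bi \<pi>" "cpt N B bi \<pi> < 1"
    and K: "insert B (pars N B) \<subseteq> K" "K \<subseteq> vars N"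
    and \<phi>: "\<And>k. k \<in> configs N K \<Longrightarrow> \<phi> k = event_prob N (\<lambda>v. restrict v K = k \<and> E v)"
  shows "event_prob (covary N B bi \<pi> x) E =
    family_sum N K \<phi> B bi \<pi> * (x / cpt N B bi \<pi>)
    + (\<Sum>bj\<in>vals N B - {bi}. family_sum N K \<phi> B bj \<pi>) * ((1 - x) / (1 - cpt N B bi \<pi>))
    + other_parents_sum N K \<phi> B \<pi>"
proof -
  define w where "w = (\<lambda>v :: 'v \<Rightarrow> 'd. if restrict v (pars N B) \<noteq> \<pi> then 1
     else if v B = bi then x / cpt N B bi \<pi> else (1 - x) / (1 - cpt N B bi \<pi>))"
  let ?V = "{v \<in> configs N (vars N). E v}"
  have finc: "finite (configs N S)" if "S \<subseteq> vars N" for S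
    using bn that by (rule finite_configs)
  have finB: "finite (vals N B)" using bn B by (simp add: bayesian_network_def)
  \<comment> \<open>The family of \<open>B\<close> lies in \<open>K\<close>, so the weight is
    constant on the set of all \<open>v\<close> that restrict to a given configuration of
    \<open>K\<close>.\<close>
  have wK: "w (restrict v K) = w v" for v
    using K by (simp add: w_def Int_absorb1)
  have "event_prob (covary N B bi \<pi> x) E = (\<Sum>v\<in>?V. w v * joint N v)"
    unfolding event_prob_def joint_covary[OF bn B(1) p] w_def
    by (simp add: covary_def configs_def)
  also have "\<dots> = (\<Sum>k\<in>configs N K. \<Sum>v\<in>{v \<in> ?V. restrict v K = k}. w v * joint N v)"
    using finc K(2) by (intro sum.group[symmetric]) (auto simp: restrict_in_configs)
  also have "\<dots> = (\<Sum>k\<in>configs N K. w k * \<phi> k)"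
  proof (rule sum.cong[OF refl])
    fix k assume k: "k \<in> configs N K"
    have "(\<Sum>v\<in>{v \<in> ?V. restrict v K = k}. w v * joint N v)
        = (\<Sum>v\<in>{v \<in> configs N (vars N). restrict v K = k \<and> E v}. w k * joint N v)"
      by (intro sum.cong) (auto simp: wK)
    then show "(\<Sum>v\<in>{v \<in> ?V. restrict v K = k}. w v * joint N v) = w k * \<phi> k"
      by (simp add: \<phi>[OF k] event_prob_def sum_distrib_left)
  qed
  also have "\<dots> = (\<Sum>b\<in>vals N B. family_sum N K (\<lambda>k. w k * \<phi> k) B b \<pi>)
      + other_parents_sum N K (\<lambda>k. w k * \<phi> k) B \<pi>"
    using K finc finB by (intro sum_configs_by_family) auto
  \<comment> \<open>The weight is 1 when the parents are not in state \<open>\<pi>\<close>. In state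
    \<open>\<pi>\<close> it depends only on whether \<open>B\<close> has the value
    \<open>bi\<close>, so all other values share one factor.\<close>
  also have "other_parents_sum N K (\<lambda>k. w k * \<phi> k) B \<pi> = other_parents_sum N K \<phi> B \<pi>"
    unfolding other_parents_sum_def by (intro sum.cong) (auto simp: w_def)
  also have "(\<Sum>b\<in>vals N B. family_sum N K (\<lambda>k. w k * \<phi> k) B b \<pi>)
      = family_sum N K (\<lambda>k. w k * \<phi> k) B bi \<pi> + (\<Sum>b\<in>vals N B - {bi}. family_sum N K (\<lambda>k. w k * \<phi> k) B b \<pi>)"
    using finB B(2) by (rule sum.remove)
  also have "family_sum N K (\<lambda>k. w k * \<phi> k) B bi \<pi> = family_sum N K \<phi> B bi \<pi> * (x / cpt N B bi \<pi>)"
    unfolding family_sum_def sum_distrib_right by (intro sum.cong) (auto simp: w_def)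
  also have "(\<Sum>b\<in>vals N B - {bi}. family_sum N K (\<lambda>k. w k * \<phi> k) B b \<pi>)
      = (\<Sum>b\<in>vals N B - {bi}. family_sum N K \<phi> B b \<pi>) * ((1 - x) / (1 - cpt N B bi \<pi>))"
    unfolding family_sum_def sum_distrib_right by (intro sum.cong refl) (auto simp: w_def)
  finally show ?thesis .
qed

theorem theorem2:
  fixes N :: "('v, 'd) bayes_net" and T :: "'v jtree"
    and A B :: 'v and a bi :: 'd and \<pi> :: "'v \<Rightarrow> 'd" and e :: "'v \<rightharpoonup> 'd"
    and home :: "'v \<Rightarrow> 'v set" and R K :: "'v set"
    and ins outs :: "('v set \<times> 'v set) list"
    and \<phi> :: "('v, 'd) potential" and \<alpha> \<beta> :: real
  assumes "bayesian_network N" and "junction_tree N T"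
    and "A \<in> vars N" and "a \<in> vals N A" and "evidence N e"
    and "B \<in> vars N" and "bi \<in> vals N B" and "\<pi> \<in> configs N (pars N B)"
    and "0 < cpt N B bi \<pi>" and "cpt N B bi \<pi> < 1"
    and "family_assignment N T home"
    and "R \<in> cliques T" and "A \<in> R"
    and "inward_schedule T R ins" and "outward_schedule T R outs"
    and "K \<in> cliques T" and "{B} \<union> pars N B \<subseteq> K"
    and "\<phi> = clique_pot (propagated_state N home e R A a ins outs) K"
    and "\<alpha> = family_sum N K \<phi> B bi \<pi> / cpt N B bi \<pi>
             - (\<Sum>bj\<in>vals N B - {bi}. family_sum N K \<phi> B bj \<pi> / (1 - cpt N B bi \<pi>))"
    and "\<beta> = (\<Sum>bj\<in>vals N B - {bi}. family_sum N K \<phi> B bj \<pi> / (1 - cpt N B bi \<pi>))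
             + other_parents_sum N K \<phi> B \<pi>"
  shows "(\<forall>k\<in>configs N K.
            \<phi> k = event_prob N (\<lambda>v. restrict v K = k \<and> v A = a \<and> agrees e (vars N) v)) \<and>
         (\<forall>x\<in>{0..1}.
            event_prob (covary N B bi \<pi> x) (\<lambda>v. v A = a \<and> agrees e (vars N) v) = \<alpha> * x + \<beta>)"
proof -
  have K: "K \<subseteq> vars N" "insert B (pars N B) \<subseteq> K"
    using assms by (auto simp: junction_tree_def)
  have \<phi>: "\<phi> k = event_prob N (\<lambda>v. restrict v K = k \<and> v A = a \<and> agrees e (vars N) v)"
    if "k \<in> configs N K" for k
    using propagated_clique_pot[OF assms(1,2,11,12,13,14,15,16) that] assms(18) by simp
  have "event_prob (covary N B bi \<pi> x) (\<lambda>v. v A = a \<and> agrees e (vars N) v) = \<alpha> * x + \<beta>" for x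
    unfolding assms(19,20) sum_divide_distrib[symmetric]
    \<comment> \<open>With \<open>p\<close> for the initial parameter, splitting
      \<open>(1 - x) / (1 - p)\<close> sends its constant part to \<open>\<beta>\<close> and its
      part linear in \<open>x\<close>, with negative sign, to \<open>\<alpha>\<close>.\<close>
    by (subst event_prob_covary[OF assms(1,6,7,9,10) K(2,1)], erule \<phi>)
      (simp add: diff_divide_distrib algebra_simps)
  with \<phi> show ?thesis by blast
qed

end
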